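(* For the 1 Or 3 CA $\lambda$ started from a uniformly random initial configuration on $\mathbb Z$, $$\mathbf P\bigl(\exists\text{ an infinite empty path from }(0,0)\bigr)>0.$$
   Context: The 1 Or 3 CA is the evolution on $\{0,1\}^{\mathbb Z}$ given by $\lambda_{t+1}(x)=\lambda_t(x-1)+\lambda_t(x)+\lambda_t(x+1)\bmod 2$, $t=0,1,2,\dots$; write $\lambda(x,t)=\lambda_t(x)$. Uniformly random on $\mathbb Z$ means that the values $\lambda_0(x)$, $x\in\mathbb Z$, are independent and take values $0,1$ with probability $1/2$ each. A path is a finite or infinite sequence of space–time points $(x_0,t_0),(x_1,t_1),\dots$ in $\mathbb Z\times[0,\infty)$ with $t_{i+1}=t_i+1$ and $|x_{i+1}-x_i|\le 1$ for all $i$. A path is empty if $\lambda(x,t)=0$ for every $(x,t)$ on it. *)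

theory Defs
  imports "HOL-Probability.Probability" "HOL-Library.Z2"
begin

text \<open>
  Cell states live in the two-element field \<open>bit\<close>, whose addition is addition modulo 2.
  A space-time point is a pair (site, time).
\<close>

fun one_or_three :: "(int \<Rightarrow> bit) \<Rightarrow> nat \<Rightarrow> int \<Rightarrow> bit" where
  "one_or_three \<xi> 0 x = \<xi> x"
| "one_or_three \<xi> (Suc t) x =
     one_or_three \<xi> t (x - 1) + one_or_three \<xi> t x + one_or_three \<xi> t (x + 1)"

definition infinite_path :: "(nat \<Rightarrow> int \<times> nat) \<Rightarrow> bool" where
  "infinite_path p \<longleftrightarrow>
     (\<forall>i. snd (p (Suc i)) = snd (p i) + 1 \<and> \<bar>fst (p (Suc i)) - fst (p i)\<bar> \<le> 1)"

definition empty_path :: "(int \<Rightarrow> bit) \<Rightarrow> (nat \<Rightarrow> int \<times> nat) \<Rightarrow> bool" where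
  "empty_path \<xi> p \<longleftrightarrow> (\<forall>i. one_or_three \<xi> (snd (p i)) (fst (p i)) = 0)"

text \<open>
  A random configuration is a family of random variables on a probability space \<open>M\<close>;
  \<open>\<xi> x\<close> is the initial state at site \<open>x\<close>.
\<close>

definition uniformly_random :: "'w measure \<Rightarrow> (int \<Rightarrow> 'w \<Rightarrow> bit) \<Rightarrow> bool" where
  "uniformly_random M \<xi> \<longleftrightarrow>
     prob_space.indep_vars M (\<lambda>_. count_space UNIV) \<xi> UNIV \<and>
     (\<forall>x. \<forall>v \<in> {0, 1}. measure M {\<omega> \<in> space M. \<xi> x \<omega> = v} = 1 / 2)"

end

theory Submission
  imports Defs
begin

text \<open>
  Since 1 + 1 + 1 = 1, every 0 has a parent 0. Hence any two walks of 0s whose steps to the right,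
  resp. left, are at most 1 (but may be long in the other direction), and which never cross, have
  an empty path between them. The greedy right walk goes from a 0 at \<open>(r, t)\<close> to the first 0 met
  when row \<open>t + 1\<close> is scanned leftwards from \<open>r + 1\<close>. Each scanned site extends the light cone of
  everything seen so far to a new initial site, so it is a fresh fair bit; a jump that met \<open>j\<close>
  ones is followed by \<open>j div 2\<close> certain steps \<open>(1, 1)\<close>, because 0 + 1 + 1 = 0. The net displacement
  of such a cycle has mean \<open>1 - E j + E (j div 2) = 1/3 > 0\<close>, so a walk started far to the right stays
  nonnegative with probability close to 1. With the mirror image of this walk, an interval of
  length 41 emits an empty path of any given length with probability bounded below.
\<close>

section \<open>Zeros and their parents; translation and reflection of the CA\<close>

lemma one_or_three_zero_parent:
  assumes "one_or_three c (Suc t) x = 0"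
  obtains y where "\<bar>y - x\<bar> \<le> 1" "one_or_three c t y = 0"
proof -
  have "one_or_three c t (x - 1) = 0 \<or> one_or_three c t x = 0 \<or> one_or_three c t (x + 1) = 0"
    using assms by (auto simp: bit_not_zero_iff)
  thus ?thesis using that[of "x - 1"] that[of x] that[of "x + 1"] by auto
qed

lemma one_or_three_shift:
  "one_or_three (\<lambda>x. c (x + a)) t x = one_or_three c t (x + a)"
proof (induction t arbitrary: x)
  case (Suc t)
  have "x - 1 + a = x + a - 1" "x + 1 + a = x + a + 1" by simp_all
  thus ?case by (simp only: one_or_three.simps Suc)
qed simp

lemma one_or_three_reflect:
  "one_or_three (\<lambda>x. c (- x)) t x = one_or_three c t (- x)"
proof (induction t arbitrary: x)
  case (Suc t)
  have "one_or_three (\<lambda>x. c (- x)) (Suc t) x =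
      one_or_three c t (- x + 1) + one_or_three c t (- x) + one_or_three c t (- x - 1)"
    by (simp only: one_or_three.simps Suc minus_diff_eq minus_add_distrib) simp
  also have "\<dots> = one_or_three c (Suc t) (- x)"
    by (simp only: one_or_three.simps add.commute add.left_commute)
  finally show ?case .
qed simp

section \<open>Finite empty paths and compactness\<close>

text \<open>Recursion on the number \<open>k\<close> of remaining steps avoids path objects and
  makes it visible that only finitely many initial sites matter.\<close>

fun empty_from :: "(int \<Rightarrow> bit) \<Rightarrow> int \<Rightarrow> nat \<Rightarrow> nat \<Rightarrow> bool" where
  "empty_from c x t 0 \<longleftrightarrow> one_or_three c t x = 0"
| "empty_from c x t (Suc k) \<longleftrightarrow>
     one_or_three c t x = 0 \<and> (\<exists>y\<in>{x - 1..x + 1}. empty_from c y (Suc t) k)"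

lemma empty_from_zero: "empty_from c x t k \<Longrightarrow> one_or_three c t x = 0"
  by (cases k) auto

lemma empty_from_Suc_imp: "empty_from c x t (Suc k) \<Longrightarrow> empty_from c x t k"
proof (induction k arbitrary: x t)
  case (Suc k)
  from Suc.prems obtain y where "y \<in> {x - 1..x + 1}" "empty_from c y (Suc t) (Suc k)"
    by (simp only: empty_from.simps(2)) blast
  with Suc.IH have "\<exists>y\<in>{x - 1..x + 1}. empty_from c y (Suc t) k" by blast
  thus ?case using empty_from_zero[OF Suc.prems] by simp
qed (auto dest: empty_from_zero)

lemma empty_from_antimono: "k \<le> l \<Longrightarrow> empty_from c x t l \<Longrightarrow> empty_from c x t k"
  by (induction rule: inc_induct) (blast dest: empty_from_Suc_imp)+

lemma empty_from_shift: "empty_from (\<lambda>x. c (x + a)) x t k \<longleftrightarrow> empty_from c (x + a) t k"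
proof (induction k arbitrary: x t)
  case (Suc k)
  have "(\<exists>y\<in>{x - 1..x + 1}. empty_from c (y + a) (Suc t) k) \<longleftrightarrow>
        (\<exists>y\<in>{x + a - 1..x + a + 1}. empty_from c y (Suc t) k)"
    (is "(\<exists>y\<in>?A. ?P (y + a)) \<longleftrightarrow> (\<exists>y\<in>?B. ?P y)")
  proof -
    have "?B = (\<lambda>y. y + a) ` ?A" by (simp add: algebra_simps)
    thus ?thesis by (metis (no_types, lifting) imageE imageI)
  qed
  thus ?case by (simp add: Suc one_or_three_shift)
qed (simp add: one_or_three_shift)

text \<open>This is the step of Koenig's lemma: if each of the three children failed at some length,
  all would fail at the maximum \<open>K\<close> of these lengths, against a path of
  \<open>Suc K\<close> steps from the parent.\<close>

lemma empty_from_extend: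
  assumes "\<And>k. empty_from c x t k"
  obtains y where "\<bar>y - x\<bar> \<le> 1" "\<And>k. empty_from c y (Suc t) k"
proof -
  have "\<exists>y\<in>{x - 1..x + 1}. \<forall>k. empty_from c y (Suc t) k"
  proof (rule ccontr)
    assume "\<not> ?thesis"
    hence "\<forall>y\<in>{x - 1..x + 1}. \<exists>k. \<not> empty_from c y (Suc t) k" by auto
    then obtain f where f: "\<And>y. y \<in> {x - 1..x + 1} \<Longrightarrow> \<not> empty_from c y (Suc t) (f y)"
      by metis
    define K where "K = Max (f ` {x - 1..x + 1})"
    have "empty_from c x t (Suc K)" by (rule assms)
    then obtain y where y: "y \<in> {x - 1..x + 1}" "empty_from c y (Suc t) K" by auto
    moreover have "f y \<le> K" unfolding K_def using y by (intro Max_ge) auto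
    ultimately show False using f empty_from_antimono by blast
  qed
  thus ?thesis using that by force
qed

text \<open>By compactness the event of the theorem is a countable intersection of events on
  finitely many sites. This gives its measurability and reduces it to a bound uniform in
  \<open>k\<close>.\<close>

lemma infinite_empty_path_iff:
  "(\<exists>p. infinite_path p \<and> p 0 = (0, 0) \<and> empty_path c p) \<longleftrightarrow> (\<forall>k. empty_from c 0 0 k)"
proof
  assume "\<exists>p. infinite_path p \<and> p 0 = (0, 0) \<and> empty_path c p"
  then obtain p where p: "infinite_path p" "p 0 = (0, 0)" "empty_path c p" by blast
  have snd_p: "snd (p i) = i" for i
    using p by (induction i) (auto simp: infinite_path_def)
  have "empty_from c (fst (p i)) i k" for i k
  proof (induction k arbitrary: i)
    case 0
    show ?case using p snd_p[of i] by (auto simp: empty_path_def dest: spec[of _ i])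
  next
    case (Suc k)
    have "\<bar>fst (p (Suc i)) - fst (p i)\<bar> \<le> 1" using p by (auto simp: infinite_path_def)
    moreover have "one_or_three c i (fst (p i)) = 0" using p snd_p[of i]
      by (auto simp: empty_path_def dest: spec[of _ i])
    ultimately show ?case using Suc[of "Suc i"] by (auto intro!: bexI[of _ "fst (p (Suc i))"])
  qed
  from this[of 0] show "\<forall>k. empty_from c 0 0 k" using p by simp
next
  assume *: "\<forall>k. empty_from c 0 0 k"
  \<comment> \<open>The conjunct for \<open>t = 0\<close> carries the starting point through the
    dependent choice.\<close>
  have "\<exists>f. \<forall>t. ((t = 0 \<longrightarrow> f t = 0) \<and> (\<forall>k. empty_from c (f t) t k)) \<and>
           \<bar>f (Suc t) - f t\<bar> \<le> 1"
  proof (intro dependent_nat_choice)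
    show "\<exists>x. (0 = (0::nat) \<longrightarrow> x = 0) \<and> (\<forall>k. empty_from c x 0 k)" using * by auto
  next
    fix x t assume "(t = 0 \<longrightarrow> x = 0) \<and> (\<forall>k. empty_from c x t k)"
    then obtain y where "\<bar>y - x\<bar> \<le> 1" "\<And>k. empty_from c y (Suc t) k"
      using empty_from_extend by metis
    thus "\<exists>y. ((Suc t = 0 \<longrightarrow> y = 0) \<and> (\<forall>k. empty_from c y (Suc t) k)) \<and> \<bar>y - x\<bar> \<le> 1" by auto
  qed
  then obtain f where f: "f 0 = 0" "\<And>t k. empty_from c (f t) t k" "\<And>t. \<bar>f (Suc t) - f t\<bar> \<le> 1"
    by auto
  have "infinite_path (\<lambda>t. (f t, t))" using f by (auto simp: infinite_path_def)
  moreover have "empty_path c (\<lambda>t. (f t, t))" using f by (auto simp: empty_path_def dest: empty_from_zero)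
  ultimately show "\<exists>p. infinite_path p \<and> p 0 = (0, 0) \<and> empty_path c p"
    using f by (intro exI[of _ "\<lambda>t. (f t, t)"]) auto
qed

section \<open>One-sided walks and the empty path between them\<close>

text \<open>The barrier \<open>b\<close> bounds jumps to the left. The next 0 is chosen
  existentially; greediness enters only in the estimate of the failure probability.\<close>

fun right_walk :: "(int \<Rightarrow> bit) \<Rightarrow> int \<Rightarrow> int \<Rightarrow> nat \<Rightarrow> nat \<Rightarrow> bool" where
  "right_walk c b r t 0 \<longleftrightarrow> one_or_three c t r = 0 \<and> b \<le> r"
| "right_walk c b r t (Suc k) \<longleftrightarrow>
     one_or_three c t r = 0 \<and> b \<le> r \<and> (\<exists>r'\<in>{b..r + 1}. right_walk c b r' (Suc t) k)"

lemma right_walk_D: "right_walk c b r t k \<Longrightarrow> one_or_three c t r = 0 \<and> b \<le> r"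
  by (cases k) auto

text \<open>The left walk is the right walk of the reflected configuration, at mirrored sites.\<close>

lemma empty_path_between_walks:
  assumes "right_walk c 0 r t k" "right_walk (\<lambda>x. c (- x)) 0 l t k"
  shows "\<exists>x\<in>{- l..r}. empty_from c x t k"
  using assms
proof (induction k arbitrary: r l t)
  case 0
  thus ?case by (auto intro!: bexI[of _ r])
next
  case (Suc k)
  from Suc.prems obtain r' l' where r': "r' \<le> r + 1" "right_walk c 0 r' (Suc t) k"
    and l': "l' \<le> l + 1" "right_walk (\<lambda>x. c (- x)) 0 l' (Suc t) k" by auto
  from Suc.prems have r: "one_or_three c t r = 0" "0 \<le> r" by auto
  from Suc.prems have l: "one_or_three c t (- l) = 0" "0 \<le> l"
    by (auto simp: one_or_three_reflect)
  from Suc.IH[OF r'(2) l'(2)] obtain x where x: "x \<in> {- l'..r'}" "empty_from c x (Suc t) k" by blast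
  from one_or_three_zero_parent[OF empty_from_zero[OF x(2)]]
  obtain z where z: "\<bar>z - x\<bar> \<le> 1" "one_or_three c t z = 0" .
  \<comment> \<open>The parent \<open>z\<close> is clamped to the interval between the walks. If
    this changes it, \<open>w\<close> is an endpoint, which is a 0 and is still adjacent to
    \<open>x\<close> because the walks move outwards by at most 1.\<close>
  define w where "w = max (- l) (min r z)"
  have "w \<in> {- l..r}" "one_or_three c t w = 0" "x \<in> {w - 1..w + 1}"
    using r l z x r' l' by (auto simp: w_def max_def min_def)
  thus ?case using x(2) by (intro bexI[of _ w]) auto
qed

text \<open>One time step turns a 0 followed by \<open>j\<close> ones into a 0 one site further
  right followed by \<open>j - 2\<close> ones: the sums are 0 + 1 + 1 = 0 and then 1 + 1 + 1 = 1. So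
  each diagonal step costs two ones.\<close>

lemma diagonal_zeros:
  assumes "one_or_three c t r = 0" "\<And>x. x \<in> {r<..r + int j} \<Longrightarrow> one_or_three c t x = 1"
    and "2 * m \<le> j"
  shows "one_or_three c (t + m) (r + int m) = 0"
  using assms
proof (induction m arbitrary: r t j)
  case (Suc m)
  have "one_or_three c (Suc t) (r + 1) = 0"
    using Suc.prems by simp
  moreover have "one_or_three c (Suc t) x = 1" if "x \<in> {r + 1<..r + 1 + int (j - 2)}" for x
    using Suc.prems that by simp
  ultimately have "one_or_three c (Suc t + m) (r + 1 + int m) = 0"
    using Suc.prems by (intro Suc.IH[of _ _ "j - 2"]) auto
  thus ?case by (simp add: algebra_simps)
qed simp

text \<open>The forced diagonal steps can be put in front of a walk. The truncated difference
  \<open>k - m\<close> also covers a horizon that is reached during these steps.\<close>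

lemma right_walk_diagonal:
  assumes "one_or_three c t r = 0" "\<And>x. x \<in> {r<..r + int j} \<Longrightarrow> one_or_three c t x = 1"
    and "2 * m \<le> j" "b \<le> r" "right_walk c b (r + int m) (t + m) (k - m)"
  shows "right_walk c b r t k"
  using assms
proof (induction m arbitrary: r t j k)
  case (Suc m)
  show ?case
  proof (cases k)
    case (Suc k')
    have zero: "one_or_three c (Suc t) (r + 1) = 0"
      using Suc.prems by simp
    have ones: "one_or_three c (Suc t) x = 1" if "x \<in> {r + 1<..r + 1 + int (j - 2)}" for x
      using Suc.prems that by simp
    have walk: "right_walk c b (r + 1 + int m) (Suc t + m) (k' - m)"
      using Suc.prems(5) Suc by (simp add: add.assoc)
    have "right_walk c b (r + 1) (Suc t) k'"
      by (rule Suc.IH[of "Suc t" "r + 1" "j - 2" k', OF zero ones _ _ walk]) (use Suc.prems(3,4) in simp_all)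
    thus ?thesis using Suc Suc.prems(1,4) by (auto intro!: bexI[of _ "r + 1"])
  qed (use Suc.prems in auto)
qed simp

section \<open>Dependence on finitely many initial sites\<close>

definition determined_on :: "int set \<Rightarrow> ((int \<Rightarrow> bit) \<Rightarrow> 'b) \<Rightarrow> bool" where
  "determined_on A Q \<longleftrightarrow> (\<forall>c c'. (\<forall>x\<in>A. c x = c' x) \<longrightarrow> Q c = Q c')"

lemma determined_onD: "determined_on A Q \<Longrightarrow> (\<And>x. x \<in> A \<Longrightarrow> c x = c' x) \<Longrightarrow> Q c = Q c'"
  unfolding determined_on_def by blast

lemma determined_on_mono: "determined_on A Q \<Longrightarrow> A \<subseteq> B \<Longrightarrow> determined_on B Q"
  unfolding determined_on_def by blast

lemma determined_on_comp1: "determined_on A P \<Longrightarrow> determined_on A (\<lambda>c. f (P c))"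
  unfolding determined_on_def by metis

lemma determined_on_comp2:
  "determined_on A P \<Longrightarrow> determined_on A Q \<Longrightarrow> determined_on A (\<lambda>c. f (P c) (Q c))"
  unfolding determined_on_def by metis

lemma determined_on_bex:
  "(\<And>y. y \<in> S \<Longrightarrow> determined_on A (\<lambda>c. Q c y)) \<Longrightarrow> determined_on A (\<lambda>c. \<exists>y\<in>S. Q c y)"
  unfolding determined_on_def by blast

lemma determined_on_one_or_three:
  "determined_on {x - int t..x + int t} (\<lambda>c. one_or_three c t x)"
proof (induction t arbitrary: x)
  case 0
  thus ?case by (auto simp: determined_on_def)
next
  case (Suc t)
  let ?A = "{x - int (Suc t)..x + int (Suc t)}"
  have "determined_on ?A (\<lambda>c. one_or_three c t y)" if "y \<in> {x - 1..x + 1}" for y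
    by (rule determined_on_mono[OF Suc[of y]]) (use that in auto)
  thus ?case unfolding one_or_three.simps by (intro determined_on_comp2[where f = "(+)"]) auto
qed

text \<open>
  In the additive CA the rightmost initial site of the light cone has coefficient 1, so
  adding it (in characteristic 2) cancels it.
\<close>

lemma determined_on_one_or_three_right:
  "determined_on {x - int t..<x + int t} (\<lambda>c. one_or_three c t x + c (x + int t))"
proof (induction t arbitrary: x)
  case 0
  thus ?case by (auto simp: determined_on_def)
next
  case (Suc t)
  let ?A = "{x - int (Suc t)..<x + int (Suc t)}"
  have "determined_on ?A (\<lambda>c. one_or_three c t (x + 1) + c (x + 1 + int t))"
    by (rule determined_on_mono[OF Suc[of "x + 1"]]) auto
  moreover have "determined_on ?A (\<lambda>c. one_or_three c t x)"
    by (rule determined_on_mono[OF determined_on_one_or_three[of x t]]) auto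
  moreover have "determined_on ?A (\<lambda>c. one_or_three c t (x - 1))"
    by (rule determined_on_mono[OF determined_on_one_or_three[of "x - 1" t]]) auto
  ultimately have "determined_on ?A (\<lambda>c. one_or_three c t (x - 1) + one_or_three c t x +
      (one_or_three c t (x + 1) + c (x + 1 + int t)))"
    by (intro determined_on_comp2[where f = "(+)", OF determined_on_comp2[where f = "(+)"]])
  moreover have "x + 1 + int t = x + int (Suc t)" by simp
  ultimately show ?case unfolding one_or_three.simps by (simp only: add.assoc)
qed

text \<open>Each step moves the path by at most 1 and widens the light cone by 1, hence the factor
  2.\<close>

lemma determined_on_empty_from:
  "determined_on {x - int (t + 2 * k)..x + int (t + 2 * k)} (\<lambda>c. empty_from c x t k)"
proof (induction k arbitrary: x t)
  case 0
  show ?case using determined_on_comp1[OF determined_on_one_or_three[of x t], of "\<lambda>v. v = 0"] by simp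
next
  case (Suc k)
  let ?A = "{x - int (t + 2 * Suc k)..x + int (t + 2 * Suc k)}"
  have "determined_on ?A (\<lambda>c. one_or_three c t x = 0)"
    by (rule determined_on_comp1[where f = "\<lambda>v. v = 0",
          OF determined_on_mono[OF determined_on_one_or_three[of x t]]]) auto
  moreover have "determined_on ?A (\<lambda>c. empty_from c y (Suc t) k)" if "y \<in> {x - 1..x + 1}" for y
    by (rule determined_on_mono[OF Suc[of y "Suc t"]]) (use that in auto)
  ultimately show ?case
    unfolding empty_from.simps by (intro determined_on_comp2[where f = "(\<and>)"] determined_on_bex)
qed

text \<open>On the right, displacement and light cone both grow by 1 per step. On the left the
  barrier stops the displacement, so only the cone grows.\<close>

lemma determined_on_right_walk:
  "determined_on {b - int (t + k)..r + int (t + 2 * k)} (\<lambda>c. right_walk c b r t k)"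
proof (cases "b \<le> r")
  case True
  thus ?thesis
  proof (induction k arbitrary: r t)
    case 0
    have "determined_on {b - int t..r + int t} (\<lambda>c. one_or_three c t r)"
      by (rule determined_on_mono[OF determined_on_one_or_three[of r t]]) (use 0 in auto)
    thus ?case using 0 determined_on_comp1[of _ _ "\<lambda>v. v = 0"] by simp
  next
    case (Suc k)
    let ?A = "{b - int (t + Suc k)..r + int (t + 2 * Suc k)}"
    have "determined_on ?A (\<lambda>c. one_or_three c t r)"
      by (rule determined_on_mono[OF determined_on_one_or_three[of r t]]) (use Suc.prems in auto)
    hence "determined_on ?A (\<lambda>c. one_or_three c t r = 0)"
      by (rule determined_on_comp1[where f = "\<lambda>v. v = 0"])
    moreover have "determined_on ?A (\<lambda>c. right_walk c b y (Suc t) k)" if "y \<in> {b..r + 1}" for y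
      by (rule determined_on_mono[OF Suc.IH[of y "Suc t"]]) (use that in auto)
    ultimately have "determined_on ?A
        (\<lambda>c. one_or_three c t r = 0 \<and> (\<exists>y\<in>{b..r + 1}. right_walk c b y (Suc t) k))"
      by (intro determined_on_comp2[where f = "(\<and>)"] determined_on_bex)
    thus ?case using Suc.prems by simp
  qed
next
  case False
  hence "\<not> right_walk c b r t k" for c using right_walk_D[of c b r t k] by auto
  thus ?thesis by (simp add: determined_on_def)
qed

lemma determined_on_reindex:
  "determined_on A Q \<Longrightarrow> determined_on (f ` A) (\<lambda>c. Q (\<lambda>x. c (f x)))"
  unfolding determined_on_def by simp

definition finitary :: "((int \<Rightarrow> bit) \<Rightarrow> bool) \<Rightarrow> bool" where
  "finitary Q \<longleftrightarrow> (\<exists>A. finite A \<and> determined_on A Q)"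

lemma finitaryI: "finite A \<Longrightarrow> determined_on A Q \<Longrightarrow> finitary Q"
  unfolding finitary_def by blast

lemma finitary_not: "finitary P \<Longrightarrow> finitary (\<lambda>c. \<not> P c)"
  unfolding finitary_def using determined_on_comp1[where f = Not] by blast

lemma finitary_conj:
  assumes "finitary P" "finitary Q"
  shows "finitary (\<lambda>c. P c \<and> Q c)"
proof -
  obtain A B where "finite A" "determined_on A P" "finite B" "determined_on B Q"
    using assms unfolding finitary_def by blast
  moreover from this have "determined_on (A \<union> B) P" "determined_on (A \<union> B) Q"
    by (auto intro: determined_on_mono)
  ultimately show ?thesis
    by (intro finitaryI[of "A \<union> B"] determined_on_comp2[where f = "(\<and>)"]) auto
qed

lemma finitary_one_or_three: "finitary (\<lambda>c. one_or_three c t x = v)"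
  by (rule finitaryI[OF _ determined_on_comp1[where f = "\<lambda>u. u = v", OF determined_on_one_or_three]]) simp

lemma finitary_empty_from: "finitary (\<lambda>c. empty_from c x t k)"
  by (rule finitaryI[OF _ determined_on_empty_from]) simp

lemma finitary_right_walk: "finitary (\<lambda>c. right_walk c b r t k)"
  by (rule finitaryI[OF _ determined_on_right_walk]) simp

lemma finitary_reindex: "finitary Q \<Longrightarrow> finitary (\<lambda>c. Q (\<lambda>x. c (f x)))"
  unfolding finitary_def using determined_on_reindex by blast

lemmas finitary_intros = finitary_not finitary_conj finitary_one_or_three finitary_empty_from
  finitary_right_walk

section \<open>Probabilities of events on finitely many sites\<close>

text \<open>Uniform randomness is stated through cylinder probabilities, a form that is easily
  checked again after relabelling sites or flipping a bit.\<close>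

locale uniform_configuration = prob_space M for M :: "'w measure" +
  fixes \<xi> :: "int \<Rightarrow> 'w \<Rightarrow> bit"
  assumes measurable_site [measurable]: "\<And>x. \<xi> x \<in> measurable M (count_space UNIV)"
    and prob_cylinder:
      "\<And>A \<sigma>. finite A \<Longrightarrow> prob {\<omega> \<in> space M. \<forall>x\<in>A. \<xi> x \<omega> = \<sigma> x} = 1 / 2 ^ card A"
begin

definition event :: "((int \<Rightarrow> bit) \<Rightarrow> bool) \<Rightarrow> 'w set" where
  "event Q = {\<omega> \<in> space M. Q (\<lambda>x. \<xi> x \<omega>)}"

abbreviation pr :: "((int \<Rightarrow> bit) \<Rightarrow> bool) \<Rightarrow> real" where
  "pr Q \<equiv> prob (event Q)"

lemma cylinder_sets: "finite A \<Longrightarrow> event (\<lambda>c. \<forall>x\<in>A. c x = \<sigma> x) \<in> sets M"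
  unfolding event_def by measurable

text \<open>The extensional functions on \<open>A\<close> provide exactly one representative of each
  pattern on \<open>A\<close>.\<close>

lemma event_eq_cylinders:
  assumes "determined_on A Q"
  shows "event Q = (\<Union>\<sigma>\<in>{\<sigma> \<in> A \<rightarrow>\<^sub>E UNIV. Q \<sigma>}. event (\<lambda>c. \<forall>x\<in>A. c x = \<sigma> x))"
proof (intro equalityI subsetI)
  fix \<omega> assume \<omega>: "\<omega> \<in> event Q"
  let ?\<sigma> = "restrict (\<lambda>x. \<xi> x \<omega>) A"
  have "Q ?\<sigma> = Q (\<lambda>x. \<xi> x \<omega>)"
    using assms by (auto simp: determined_on_def)
  thus "\<omega> \<in> (\<Union>\<sigma>\<in>{\<sigma> \<in> A \<rightarrow>\<^sub>E UNIV. Q \<sigma>}. event (\<lambda>c. \<forall>x\<in>A. c x = \<sigma> x))"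
    using \<omega> by (intro UN_I[of ?\<sigma>]) (auto simp: event_def)
next
  fix \<omega> assume "\<omega> \<in> (\<Union>\<sigma>\<in>{\<sigma> \<in> A \<rightarrow>\<^sub>E UNIV. Q \<sigma>}. event (\<lambda>c. \<forall>x\<in>A. c x = \<sigma> x))"
  then obtain \<sigma> where \<sigma>: "Q \<sigma>" "\<omega> \<in> space M" "\<And>x. x \<in> A \<Longrightarrow> \<xi> x \<omega> = \<sigma> x"
    by (auto simp: event_def)
  moreover have "Q (\<lambda>x. \<xi> x \<omega>) = Q \<sigma>"
    using assms \<sigma>(3) by (auto simp: determined_on_def)
  ultimately show "\<omega> \<in> event Q" by (simp add: event_def)
qed

lemma finite_configurations: "finite A \<Longrightarrow> finite {\<sigma> \<in> A \<rightarrow>\<^sub>E (UNIV :: bit set). Q \<sigma>}"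
proof -
  have "(UNIV :: bit set) = {0, 1}" by (auto intro: bit.exhaust)
  hence "finite (UNIV :: bit set)" by (metis finite.emptyI finite.insertI)
  thus "finite A \<Longrightarrow> ?thesis" by (simp add: finite_PiE)
qed

lemma event_sets:
  assumes "finitary Q"
  shows "event Q \<in> sets M"
proof -
  obtain A where "finite A" "determined_on A Q" using assms unfolding finitary_def by blast
  thus ?thesis unfolding event_eq_cylinders[OF \<open>determined_on A Q\<close>]
    by (intro sets.finite_UN finite_configurations cylinder_sets)
qed

lemma pr_mono: "finitary Q \<Longrightarrow> (\<And>c. P c \<Longrightarrow> Q c) \<Longrightarrow> pr P \<le> pr Q"
  by (rule finite_measure_mono[OF _ event_sets]) (auto simp: event_def)

lemma pr_split:
  assumes "finitary P" "finitary Q"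
  shows "pr P = pr (\<lambda>c. P c \<and> Q c) + pr (\<lambda>c. P c \<and> \<not> Q c)"
proof -
  have "event P = event (\<lambda>c. P c \<and> Q c) \<union> event (\<lambda>c. P c \<and> \<not> Q c)"
    "event (\<lambda>c. P c \<and> Q c) \<inter> event (\<lambda>c. P c \<and> \<not> Q c) = {}"
    by (auto simp: event_def)
  thus ?thesis using assms
    by (simp add: finite_measure_Union event_sets finitary_intros)
qed

text \<open>The right-hand side does not mention \<open>\<xi>\<close>. Hence any two uniform
  configurations give such an event the same probability, which is how the symmetries of the law are
  transferred below.\<close>

lemma pr_eq_card:
  assumes "finite A" "determined_on A Q"
  shows "pr Q = card {\<sigma> \<in> A \<rightarrow>\<^sub>E UNIV. Q \<sigma>} / 2 ^ card A"
proof -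
  have "disjoint_family_on (\<lambda>\<sigma>. event (\<lambda>c. \<forall>x\<in>A. c x = \<sigma> x)) {\<sigma> \<in> A \<rightarrow>\<^sub>E UNIV. Q \<sigma>}"
    unfolding disjoint_family_on_def
  proof (intro ballI impI)
    fix \<sigma> \<tau> assume "\<sigma> \<in> {\<sigma> \<in> A \<rightarrow>\<^sub>E UNIV. Q \<sigma>}" "\<tau> \<in> {\<sigma> \<in> A \<rightarrow>\<^sub>E UNIV. Q \<sigma>}" "\<sigma> \<noteq> \<tau>"
    hence "\<exists>x\<in>A. \<sigma> x \<noteq> \<tau> x" by (metis (lifting) PiE_ext mem_Collect_eq)
    thus "event (\<lambda>c. \<forall>x\<in>A. c x = \<sigma> x) \<inter> event (\<lambda>c. \<forall>x\<in>A. c x = \<tau> x) = {}"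
      by (auto simp: event_def simp del: bit_not_zero_iff bit_not_one_iff)
  qed
  hence "pr Q = (\<Sum>\<sigma>\<in>{\<sigma> \<in> A \<rightarrow>\<^sub>E UNIV. Q \<sigma>}. pr (\<lambda>c. \<forall>x\<in>A. c x = \<sigma> x))"
    unfolding event_eq_cylinders[OF assms(2)]
    by (intro finite_measure_finite_Union finite_configurations assms) (auto intro: cylinder_sets assms)
  thus ?thesis by (simp add: event_def prob_cylinder assms)
qed

end

lemma uniform_configurationI:
  assumes "prob_space M" "uniformly_random M \<xi>"
  shows "uniform_configuration M \<xi>"
proof -
  interpret prob_space M by fact
  have indep: "indep_vars (\<lambda>_. count_space UNIV) \<xi> UNIV"
    using assms by (simp add: uniformly_random_def)
  have site: "prob (\<xi> x -` {v} \<inter> space M) = 1 / 2" for x v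
  proof -
    have "prob {\<omega> \<in> space M. \<xi> x \<omega> = v} = 1 / 2"
      using assms by (cases v) (simp_all add: uniformly_random_def)
    moreover have "{\<omega> \<in> space M. \<xi> x \<omega> = v} = \<xi> x -` {v} \<inter> space M" by auto
    ultimately show ?thesis by simp
  qed
  show ?thesis
  proof
    show "\<xi> x \<in> measurable M (count_space UNIV)" for x
      using indep by (auto simp: indep_vars_def)
  next
    fix A :: "int set" and \<sigma>
    assume "finite A"
    show "prob {\<omega> \<in> space M. \<forall>x\<in>A. \<xi> x \<omega> = \<sigma> x} = 1 / 2 ^ card A"
    proof (cases "A = {}")
      case False
      hence "{\<omega> \<in> space M. \<forall>x\<in>A. \<xi> x \<omega> = \<sigma> x} = (\<Inter>x\<in>A. \<xi> x -` {\<sigma> x} \<inter> space M)"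
        by auto
      also have "prob \<dots> = (\<Prod>x\<in>A. prob (\<xi> x -` {\<sigma> x} \<inter> space M))"
        by (rule indep_varsD[OF indep]) (use \<open>finite A\<close> False in auto)
      finally show ?thesis by (simp add: site power_one_over)
    qed (simp add: prob_space)
  qed
qed

lemma uniform_configuration_reindex:
  assumes "uniform_configuration M \<xi>" "inj f"
  shows "uniform_configuration M (\<lambda>x. \<xi> (f x))"
proof -
  interpret uniform_configuration M \<xi> by fact
  show ?thesis
  proof
    fix A :: "int set" and \<sigma>
    assume "finite A"
    have "(\<forall>x\<in>A. \<xi> (f x) \<omega> = \<sigma> x) \<longleftrightarrow> (\<forall>y\<in>f ` A. \<xi> y \<omega> = \<sigma> (inv f y))" for \<omega>
      using assms(2) by auto
    moreover have "card (f ` A) = card A"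
      using assms(2) by (simp add: card_image inj_on_subset)
    ultimately show "prob {\<omega> \<in> space M. \<forall>x\<in>A. \<xi> (f x) \<omega> = \<sigma> x} = 1 / 2 ^ card A"
      using prob_cylinder[of "f ` A" "\<lambda>y. \<sigma> (inv f y)"] \<open>finite A\<close> by simp
  qed measurable
qed

text \<open>Flipping the bit at \<open>y\<close> in the configuration amounts to flipping it in the
  prescribed pattern, and all patterns on \<open>A\<close> are equally likely.\<close>

lemma uniform_configuration_flip:
  assumes "uniform_configuration M \<xi>"
  shows "uniform_configuration M (\<lambda>x \<omega>. if x = y then \<xi> x \<omega> + 1 else \<xi> x \<omega>)"
proof -
  interpret uniform_configuration M \<xi> by fact
  show ?thesis
  proof
    fix A :: "int set" and \<sigma>
    assume "finite A"
    have "v + 1 = w \<longleftrightarrow> v = w + 1" for v w :: bit by (cases v; cases w) auto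
    hence "(\<forall>x\<in>A. (if x = y then \<xi> x \<omega> + 1 else \<xi> x \<omega>) = \<sigma> x) \<longleftrightarrow>
        (\<forall>x\<in>A. \<xi> x \<omega> = (if x = y then \<sigma> x + 1 else \<sigma> x))" for \<omega>
      by (auto split: if_splits)
    thus "prob {\<omega> \<in> space M. \<forall>x\<in>A. (if x = y then \<xi> x \<omega> + 1 else \<xi> x \<omega>) = \<sigma> x} = 1 / 2 ^ card A"
      using prob_cylinder[OF \<open>finite A\<close>] by simp
  next
    fix x
    show "(\<lambda>\<omega>. if x = y then \<xi> x \<omega> + 1 else \<xi> x \<omega>) \<in> measurable M (count_space UNIV)"
      by (rule measurable_compose[OF measurable_site[of x], of "\<lambda>v. if x = y then v + 1 else v"]) simp
  qed
qed

section \<open>Symmetries of the law, fresh bits and survival of the walks\<close>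

context uniform_configuration
begin

lemma pr_reindex:
  assumes "finitary Q" "inj f"
  shows "pr (\<lambda>c. Q (\<lambda>x. c (f x))) = pr Q"
proof -
  obtain A where A: "finite A" "determined_on A Q" using assms unfolding finitary_def by blast
  interpret R: uniform_configuration M "\<lambda>x. \<xi> (f x)"
    by (rule uniform_configuration_reindex) (unfold_locales, fact)
  show ?thesis using R.pr_eq_card[OF A] pr_eq_card[OF A]
    by (simp add: event_def R.event_def)
qed

text \<open>Adding 1 at \<open>y\<close> preserves the law and exchanges the two outcomes.\<close>

lemma pr_fresh_site:
  assumes Q: "determined_on A Q" and g: "determined_on A g" and "finite A" "y \<notin> A"
  shows "pr (\<lambda>c. Q c \<and> c y = g c) = pr Q / 2"
proof -
  interpret F: uniform_configuration M "\<lambda>x \<omega>. if x = y then \<xi> x \<omega> + 1 else \<xi> x \<omega>"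
    by (rule uniform_configuration_flip) unfold_locales
  have det: "determined_on (insert y A) Q" "determined_on (insert y A) g"
    "determined_on (insert y A) (\<lambda>c. c y)"
    using Q g by (auto simp: determined_on_def)
  hence det': "determined_on (insert y A) (\<lambda>c. Q c \<and> c y = g c)"
    by (intro determined_on_comp2[where f = "(\<and>)", OF _ determined_on_comp2[where f = "(=)"]])
  from det have det'': "determined_on (insert y A) (\<lambda>c. Q c \<and> c y \<noteq> g c)"
    by (intro determined_on_comp2[where f = "(\<and>)", OF _ determined_on_comp2[where f = "(\<noteq>)"]])
  \<comment> \<open>The flip at \<open>y\<close> leaves \<open>Q\<close> and \<open>g\<close>
    unchanged, because they see only \<open>A\<close>.\<close>
  have "F.event (\<lambda>c. Q c \<and> c y = g c) = event (\<lambda>c. Q c \<and> c y \<noteq> g c)"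
  proof -
    have "Q (\<lambda>x. if x = y then \<xi> x \<omega> + 1 else \<xi> x \<omega>) = Q (\<lambda>x. \<xi> x \<omega>)"
      "g (\<lambda>x. if x = y then \<xi> x \<omega> + 1 else \<xi> x \<omega>) = g (\<lambda>x. \<xi> x \<omega>)" for \<omega>
      using assms(4) by (auto intro!: determined_onD[OF Q] determined_onD[OF g])
    moreover have "v + 1 = w \<longleftrightarrow> v \<noteq> w" for v w :: bit by (cases v; cases w) auto
    ultimately show ?thesis unfolding event_def F.event_def by auto
  qed
  moreover have "F.pr (\<lambda>c. Q c \<and> c y = g c) = pr (\<lambda>c. Q c \<and> c y = g c)"
    using F.pr_eq_card[OF _ det'] pr_eq_card[OF _ det'] assms by simp
  ultimately have "pr (\<lambda>c. Q c \<and> c y = g c) = pr (\<lambda>c. Q c \<and> c y \<noteq> g c)" by simp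
  moreover have "pr Q = pr (\<lambda>c. Q c \<and> c y = g c) + pr (\<lambda>c. Q c \<and> c y \<noteq> g c)"
    by (rule pr_split; rule finitaryI[of "insert y A"])
       (use assms det determined_on_comp2[where f = "(=)"] in auto)
  ultimately show ?thesis by simp
qed

text \<open>The rightmost site \<open>x + int t\<close> of the light cone lies beyond everything
  \<open>Q\<close> sees. Given the other sites, exactly one value of it, \<open>?g\<close>, produces
  the state \<open>v\<close>.\<close>

lemma pr_fresh_right:
  assumes Q: "determined_on {a..b} Q" and "b < x + int t"
  shows "pr (\<lambda>c. Q c \<and> one_or_three c t x = v) = pr Q / 2"
proof -
  let ?A = "{a..b} \<union> {x - int t..<x + int t}"
  let ?g = "\<lambda>c. v + (one_or_three c t x + c (x + int t))"
  have "determined_on ?A Q"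
    using Q by (rule determined_on_mono) simp
  moreover have "determined_on ?A ?g"
    by (rule determined_on_comp1[where f = "(+) v",
          OF determined_on_mono[OF determined_on_one_or_three_right[of x t]]]) simp
  moreover have "c (x + int t) = ?g c \<longleftrightarrow> one_or_three c t x = v" for c
    by (cases "c (x + int t)"; cases "one_or_three c t x"; cases v) auto
  ultimately show ?thesis
    using pr_fresh_site[of ?A Q ?g "x + int t"] assms(2) by simp
qed

lemma pr_fresh_left:
  assumes Q: "determined_on {a..b} Q" and "x - int t < a"
  shows "pr (\<lambda>c. Q c \<and> one_or_three c t x = v) = pr Q / 2"
proof -
  have fin: "finitary Q" using Q by (rule finitaryI[rotated]) simp
  let ?R = "\<lambda>c. Q (\<lambda>x. c (- x))"
  have "determined_on {- b..- a} ?R"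
    using determined_on_reindex[OF Q, of uminus] by simp
  hence "pr (\<lambda>c. ?R c \<and> one_or_three c t (- x) = v) = pr ?R / 2"
    by (rule pr_fresh_right) (use assms(2) in simp)
  moreover have "pr ?R = pr Q"
    by (rule pr_reindex[OF fin]) (simp add: inj_def)
  moreover have "pr (\<lambda>c. ?R c \<and> one_or_three (\<lambda>x. c (- x)) t x = v) =
      pr (\<lambda>c. Q c \<and> one_or_three c t x = v)"
    by (rule pr_reindex[where Q = "\<lambda>c. Q c \<and> one_or_three c t x = v"])
       (auto simp: inj_def intro: finitary_conj finitary_one_or_three fin)
  ultimately show ?thesis by (simp add: one_or_three_reflect)
qed

text \<open>
  The failure bound is a supermartingale for the greedy walk. The factor 4/5 is any number for
  which the exponential moment of a cycle is below 1. In \<open>scan\<close>, \<open>j\<close> ones have been met, the next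
  candidate is at height \<open>e - 1\<close> above \<open>b\<close>, and the summand \<open>1 / 2 ^ e\<close> accounts for scanning down
  past \<open>b\<close>; the weights 95/8 and 11 are a supersolution of the recursion on the parity of \<open>j\<close>.
\<close>

lemma pr_right_walk_fails:
  assumes "determined_on {r - int t..r + int t + 1} E"
    and "\<And>c. E c \<Longrightarrow> one_or_three c t r = 0" and "b \<le> r"
  shows "pr (\<lambda>c. E c \<and> \<not> right_walk c b r t k) \<le> pr E * (10 * (4 / 5) ^ nat (r - b + 1))"
  using assms
\<comment> \<open>The induction is strong because one cycle uses up a jump and all the diagonal
  steps after it.\<close>
proof (induction k arbitrary: r t E rule: less_induct)
  case (less k)
  show ?case
  proof (cases k)
    case 0
    hence "event (\<lambda>c. E c \<and> \<not> right_walk c b r t k) = {}"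
      using less.prems by (auto simp: event_def)
    thus ?thesis by simp
  next
    case (Suc k')
    define w :: "nat \<Rightarrow> real" where "w j = (if even j then 95 / 8 else 11)" for j
    \<comment> \<open>The first candidate \<open>r + 1\<close> brings in the new site
      \<open>r + int t + 2\<close> on the right. Every later candidate brings in a new site on the
      left, so the window changes shape after \<open>j = 0\<close>.\<close>
    have scan: "pr (\<lambda>c. F c \<and> \<not> right_walk c b r t k) \<le>
        pr F * (w j * (4 / 5) ^ (e + j div 2) + 1 / 2 ^ e)"
      if "r + 2 = b + int e + int j"
        "determined_on (if j = 0 then {r - int t..r + int t + 1}
           else {r + 1 - int j - int t..r + int t + 2}) F"
        "\<And>c. F c \<Longrightarrow> one_or_three c t r = 0"
        "\<And>c x. F c \<Longrightarrow> x \<in> {r + 1 - int j<..r + 1} \<Longrightarrow> one_or_three c (Suc t) x = 1"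
      for e j F
      using that
    proof (induction e arbitrary: j F)
      case 0
      \<comment> \<open>The scan has passed the barrier; the summand \<open>1 / 2 ^ 0\<close> alone
        pays for all of \<open>F\<close>.\<close>
      have "pr (\<lambda>c. F c \<and> \<not> right_walk c b r t k) \<le> pr F"
        by (rule pr_mono) (use finitaryI[OF _ 0(2)] in auto)
      also have "\<dots> \<le> pr F * (w j * (4 / 5) ^ (0 + j div 2) + 1 / 2 ^ 0)"
        by (simp add: w_def distrib_left)
      finally show ?case .
    next
      case (Suc e)
      define y where "y = r + 1 - int j"
      define m where "m = j div 2"
      have b_eq: "b = y - int e" using Suc.prems(1) by (simp add: y_def)
      have finF: "finitary F" using finitaryI[OF _ Suc.prems(2)] by auto
      have fresh: "pr (\<lambda>c. F c \<and> one_or_three c (Suc t) y = v) = pr F / 2" for v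
      proof (cases "j = 0")
        case True
        show ?thesis by (rule pr_fresh_right[of "r - int t" "r + int t + 1"])
            (use True Suc.prems(2) in \<open>simp_all add: y_def\<close>)
      next
        case False
        show ?thesis by (rule pr_fresh_left[of "y - int t" "r + int t + 2"])
            (use False Suc.prems(2) in \<open>simp_all add: y_def\<close>)
      qed
      have det: "determined_on {y - int (Suc t)..r + int t + 2} (\<lambda>c. F c \<and> one_or_three c (Suc t) y = v)"
        for v
      proof -
        have "determined_on {y - int (Suc t)..r + int t + 2} F"
          by (rule determined_on_mono[OF Suc.prems(2)]) (auto simp: y_def)
        moreover have "determined_on {y - int (Suc t)..r + int t + 2} (\<lambda>c. one_or_three c (Suc t) y = v)"
          by (rule determined_on_comp1[where f = "\<lambda>u. u = v",
                OF determined_on_mono[OF determined_on_one_or_three[of y "Suc t"]]])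
             (auto simp: y_def)
        ultimately show ?thesis by (rule determined_on_comp2[where f = "(\<and>)"])
      qed
      have ones: "one_or_three c (Suc t) x = 1" if "F c" "x \<in> {y<..y + int j}" for c x
        using Suc.prems(4)[of c x] that by (simp add: y_def)
      let ?G = "\<lambda>c. F c \<and> one_or_three c (Suc t) y = 0"
      let ?H = "\<lambda>c. F c \<and> one_or_three c (Suc t) y = 1"
      have "pr (\<lambda>c. ?G c \<and> \<not> right_walk c b r t k) \<le>
          pr (\<lambda>c. ?G c \<and> \<not> right_walk c b (y + int m) (Suc t + m) (k' - m))"
      proof (rule pr_mono)
        show "finitary (\<lambda>c. ?G c \<and> \<not> right_walk c b (y + int m) (Suc t + m) (k' - m))"
          by (intro finitary_intros finF)
      next
        fix c assume *: "?G c \<and> \<not> right_walk c b r t k"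
        have "right_walk c b y (Suc t) k'" if "right_walk c b (y + int m) (Suc t + m) (k' - m)"
          by (rule right_walk_diagonal[OF _ _ _ _ that, where j = j])
             (use * ones b_eq in \<open>auto simp: m_def\<close>)
        moreover have "\<not> right_walk c b y (Suc t) k'"
          using * \<open>k = Suc k'\<close> Suc.prems(3)[of c] less.prems(3) b_eq by (auto simp: y_def)
        ultimately show "?G c \<and> \<not> right_walk c b (y + int m) (Suc t + m) (k' - m)"
          using * by blast
      qed
      also have "\<dots> \<le> pr ?G * (10 * (4 / 5) ^ nat (y + int m - b + 1))"
      proof (rule less.IH)
        show "k' - m < k" using \<open>k = Suc k'\<close> by simp
        \<comment> \<open>The diagonal steps restore the window required of \<open>E\<close>: its
          right end is \<open>r + int t + 3\<close> minus the remainder of \<open>j\<close> modulo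
          2, and the spare site on the right in that window is what absorbs an odd
          \<open>j\<close>.\<close>
        show "determined_on {y + int m - int (Suc t + m)..y + int m + int (Suc t + m) + 1} ?G"
          by (rule determined_on_mono[OF det]) (auto simp: y_def m_def)
        show "one_or_three c (Suc t + m) (y + int m) = 0" if "?G c" for c
          by (rule diagonal_zeros[where j = j]) (use that ones in \<open>auto simp: m_def\<close>)
        show "b \<le> y + int m" using b_eq by simp
      qed
      also have "nat (y + int m - b + 1) = Suc e + m" using b_eq by simp
      finally have success: "pr (\<lambda>c. ?G c \<and> \<not> right_walk c b r t k) \<le>
          pr F / 2 * (10 * (4 / 5) ^ (Suc e + m))" unfolding fresh .
      have "pr (\<lambda>c. ?H c \<and> \<not> right_walk c b r t k) \<le>
          pr ?H * (w (Suc j) * (4 / 5) ^ (e + Suc j div 2) + 1 / 2 ^ e)"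
      proof (rule Suc.IH)
        show "r + 2 = b + int e + int (Suc j)" using Suc.prems(1) by simp
        show "determined_on (if Suc j = 0 then {r - int t..r + int t + 1}
           else {r + 1 - int (Suc j) - int t..r + int t + 2}) ?H"
          using det[of 1] by (simp add: y_def algebra_simps)
        show "one_or_three c t r = 0" if "?H c" for c using that Suc.prems(3) by blast
        show "one_or_three c (Suc t) x = 1" if "?H c" "x \<in> {r + 1 - int (Suc j)<..r + 1}" for c x
        proof (cases "x = y")
          case False
          thus ?thesis using that ones[of c x] by (auto simp: y_def)
        qed (use that in simp)
      qed
      hence failure: "pr (\<lambda>c. ?H c \<and> \<not> right_walk c b r t k) \<le>
          pr F / 2 * (w (Suc j) * (4 / 5) ^ (e + Suc j div 2) + 1 / 2 ^ e)" unfolding fresh .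
      \<comment> \<open>After division by the common power this reads 5 + (5/4) * 11/2 = 95/8 for
        even \<open>j\<close>, and 5 + (95/8)/2 = 175/16 \<le> 11 for odd \<open>j\<close>.\<close>
      have weights: "5 * (4 / 5) ^ (Suc e + m) + w (Suc j) * (4 / 5) ^ (e + Suc j div 2) / 2 \<le>
          w j * (4 / 5) ^ (Suc e + m)"
      proof (cases "even j")
        case True
        hence "Suc j div 2 = m" by (simp add: m_def)
        thus ?thesis using True by (simp add: w_def)
      next
        case False
        hence "Suc j div 2 = Suc m" by (simp add: m_def)
        thus ?thesis using False by (simp add: w_def)
      qed
      have "pr (\<lambda>c. F c \<and> \<not> right_walk c b r t k) =
          pr (\<lambda>c. (F c \<and> \<not> right_walk c b r t k) \<and> one_or_three c (Suc t) y = 0) +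
          pr (\<lambda>c. (F c \<and> \<not> right_walk c b r t k) \<and> one_or_three c (Suc t) y \<noteq> 0)"
        by (intro pr_split finitary_intros finF)
      also have "\<dots> = pr (\<lambda>c. ?G c \<and> \<not> right_walk c b r t k) + pr (\<lambda>c. ?H c \<and> \<not> right_walk c b r t k)"
        by (simp add: conj_ac)
      also have "\<dots> \<le> pr F * (5 * (4 / 5) ^ (Suc e + m) + w (Suc j) * (4 / 5) ^ (e + Suc j div 2) / 2
          + 1 / 2 ^ Suc e)"
        using success failure by (simp add: algebra_simps)
      also have "\<dots> \<le> pr F * (w j * (4 / 5) ^ (Suc e + m) + 1 / 2 ^ Suc e)"
        using weights by (intro mult_left_mono add_right_mono) auto
      finally show ?case by (simp add: m_def)
    qed
    define d where "d = nat (r - b + 1)"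
    have "pr (\<lambda>c. E c \<and> \<not> right_walk c b r t k) \<le>
        pr E * (w 0 * (4 / 5) ^ (Suc d + 0 div 2) + 1 / 2 ^ Suc d)"
      by (rule scan) (use less.prems in \<open>auto simp: d_def\<close>)
    also have "\<dots> \<le> pr E * (10 * (4 / 5) ^ d)"
    proof (rule mult_left_mono)
      \<comment> \<open>The constant 10 arises here: (95/8) * (4/5) = 19/2, and the last summand is
        at most half of \<open>(4 / 5) ^ d\<close>.\<close>
      have "(1 / 2 :: real) ^ d \<le> (4 / 5) ^ d" by (rule power_mono) auto
      thus "w 0 * (4 / 5) ^ (Suc d + 0 div 2) + 1 / 2 ^ Suc d \<le> 10 * (4 / 5) ^ d"
        by (simp add: w_def power_one_over)
    qed simp
    finally show ?thesis by (simp add: d_def)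
  qed
qed

text \<open>Both ends of the interval from -20 to 20 are 0 with probability 1/4, and each walk fails
  with probability at most 1/20. The remaining 3/20 is shared among 41 sites, and 3/820 exceeds
  1/400.\<close>

lemma pr_empty_from_ge: "pr (\<lambda>c. empty_from c 0 0 k) \<ge> 1 / 400"
proof -
  let ?Z = "\<lambda>c. one_or_three c 0 20 = 0 \<and> one_or_three c 0 (- 20) = 0"
  let ?W = "\<lambda>c. right_walk c 0 20 0 k"
  let ?E = "\<lambda>c. one_or_three c 0 20 = 0"
  let ?V = "\<lambda>c. right_walk (\<lambda>x. c (- x)) 0 20 0 k"
  let ?P = "\<lambda>c. \<exists>x\<in>{- 20..20}. empty_from c x 0 k"
  have det: "determined_on {20 - int 0..20 + int 0 + 1} ?E"
    by (simp add: determined_on_def)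
  have half: "pr ?E = 1 / 2"
    using pr_fresh_right[of 0 0 "\<lambda>_. True" 20 0 0] prob_space
    by (simp add: determined_on_def event_def)
  have "pr ?Z = 1 / 4"
    using pr_fresh_left[of 20 20 ?E "- 20" 0 0] half by (simp add: determined_on_def)
  have fails: "pr (\<lambda>c. ?E c \<and> \<not> ?W c) \<le> 1 / 20"
  proof -
    have "pr (\<lambda>c. ?E c \<and> \<not> ?W c) \<le> pr ?E * (10 * (4 / 5) ^ nat (20 - 0 + 1))"
      by (rule pr_right_walk_fails[OF det]) auto
    \<comment> \<open>Numerically, 5 * (4/5)^21 is about 0.046.\<close>
    also have "\<dots> \<le> 1 / 20" unfolding half by (simp add: power_divide)
    finally show ?thesis .
  qed
  have reflect: "pr (\<lambda>c. ?E (\<lambda>x. c (- x)) \<and> \<not> ?W (\<lambda>x. c (- x))) = pr (\<lambda>c. ?E c \<and> \<not> ?W c)"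
    by (rule pr_reindex[where Q = "\<lambda>c. ?E c \<and> \<not> ?W c"])
       (intro finitary_intros, simp add: inj_def)
  have finP: "finitary ?P"
  proof (rule finitaryI)
    show "determined_on {- 20 - int (2 * k)..20 + int (2 * k)} ?P"
    proof (rule determined_on_bex)
      fix x :: int assume "x \<in> {- 20..20}"
      thus "determined_on {- 20 - int (2 * k)..20 + int (2 * k)} (\<lambda>c. empty_from c x 0 k)"
        by (intro determined_on_mono[OF determined_on_empty_from[of x 0 k]]) auto
    qed
  qed simp
  have finV: "finitary ?V" by (rule finitary_reindex[OF finitary_right_walk])
  \<comment> \<open>A union bound suffices, so the possible dependence between the two walks does no
    harm.\<close>
  have "pr ?Z \<le> pr ?P + pr (\<lambda>c. ?E c \<and> \<not> ?W c) +
      pr (\<lambda>c. ?E (\<lambda>x. c (- x)) \<and> \<not> ?V c)"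
  proof -
    have "pr ?Z = pr (\<lambda>c. ?Z c \<and> ?W c) + pr (\<lambda>c. ?Z c \<and> \<not> ?W c)"
      by (intro pr_split finitary_intros)
    also have "pr (\<lambda>c. ?Z c \<and> ?W c) =
        pr (\<lambda>c. (?Z c \<and> ?W c) \<and> ?V c) + pr (\<lambda>c. (?Z c \<and> ?W c) \<and> \<not> ?V c)"
      by (intro pr_split finitary_intros finV)
    also have "pr (\<lambda>c. (?Z c \<and> ?W c) \<and> ?V c) \<le> pr ?P"
      using empty_path_between_walks by (intro pr_mono finP) blast
    also have "pr (\<lambda>c. ?Z c \<and> \<not> ?W c) \<le> pr (\<lambda>c. ?E c \<and> \<not> ?W c)"
      by (rule pr_mono) (intro finitary_intros, blast)
    also have "pr (\<lambda>c. (?Z c \<and> ?W c) \<and> \<not> ?V c) \<le>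
        pr (\<lambda>c. ?E (\<lambda>x. c (- x)) \<and> \<not> ?V c)"
      by (rule pr_mono)
         (intro finitary_conj finitary_not finV finitary_reindex[OF finitary_one_or_three], simp)
    finally show ?thesis by simp
  qed
  moreover have "pr ?P \<le> 41 * pr (\<lambda>c. empty_from c 0 0 k)"
  proof -
    have "pr ?P \<le> prob (\<Union>x\<in>{- 20..20}. event (\<lambda>c. empty_from c x 0 k))"
      by (rule finite_measure_mono) (auto simp: event_def intro!: event_sets[unfolded event_def] finitary_empty_from)
    also have "\<dots> \<le> (\<Sum>x\<in>{- 20..20}. pr (\<lambda>c. empty_from c x 0 k))"
      by (rule finite_measure_subadditive_finite) (auto intro: event_sets finitary_empty_from)
    also have "\<dots> = (\<Sum>x::int\<in>{- 20..20}. pr (\<lambda>c. empty_from c 0 0 k))"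
    proof (rule sum.cong)
      fix x :: int
      show "pr (\<lambda>c. empty_from c x 0 k) = pr (\<lambda>c. empty_from c 0 0 k)"
        using pr_reindex[OF finitary_empty_from[of 0 0 k], of "\<lambda>y. y + x"]
        by (simp add: empty_from_shift inj_def)
    qed simp
    finally show ?thesis by simp
  qed
  ultimately show ?thesis using \<open>pr ?Z = 1 / 4\<close> fails reflect by simp
qed

end

theorem theorem1p6:
  fixes M :: "'w measure" and \<xi> :: "int \<Rightarrow> 'w \<Rightarrow> bit"
  assumes "prob_space M"
    and "uniformly_random M \<xi>"
  shows "measure M {\<omega> \<in> space M. \<exists>p. infinite_path p \<and> p 0 = (0, 0) \<and>
           empty_path (\<lambda>x. \<xi> x \<omega>) p} > 0"
proof -
  interpret uniform_configuration M \<xi>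
    using assms by (rule uniform_configurationI)
  let ?A = "\<lambda>k. event (\<lambda>c. empty_from c 0 0 k)"
  \<comment> \<open>Continuity from above along decreasing events carries the bound, which is
    uniform in \<open>k\<close>, to the limit.\<close>
  have "(\<lambda>k. prob (?A k)) \<longlonglongrightarrow> prob (\<Inter>k. ?A k)"
  proof (rule finite_Lim_measure_decseq)
    show "range ?A \<subseteq> events" by (auto intro: event_sets finitary_empty_from)
    show "decseq ?A"
      by (rule decseq_SucI) (auto simp: event_def simp del: empty_from.simps dest: empty_from_Suc_imp)
  qed
  hence "1 / 400 \<le> prob (\<Inter>k. ?A k)"
    by (rule LIMSEQ_le_const) (use pr_empty_from_ge in blast)
  moreover have "(\<Inter>k. ?A k) = {\<omega> \<in> space M. \<exists>p. infinite_path p \<and> p 0 = (0, 0) \<and>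
      empty_path (\<lambda>x. \<xi> x \<omega>) p}"
    by (auto simp: event_def infinite_empty_path_iff)
  ultimately show ?thesis by simp
qed

end
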